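(* Let $(L,[\cdot,\cdot,\cdot],\alpha,\beta)$ be a $3$-Bihom-Lie algebra over a field $\mathbb{K}$ with $\alpha,\beta$ surjective. Then $L$ has a strict product structure if and only if $L=L_+\oplus L_-$ (direct sum of vector spaces), where $L_+$ and $L_-$ are Bihom subalgebras of $L$ such that $[L_+,L_+,L_-]=0$ and $[L_-,L_-,L_+]=0$.
   Context: A $3$-Bihom-Lie algebra over a field $\mathbb{K}$ is a $4$-tuple $(L,[\cdot,\cdot,\cdot],\alpha,\beta)$ consisting of a $\mathbb{K}$-vector space $L$, a $3$-linear map $[\cdot,\cdot,\cdot]\colon L\times L\times L\to L$ and two linear maps $\alpha,\beta\colon L\to L$ such that for all $x,y,z,u,v\in L$: (1) $\alpha\beta=\beta\alpha$; (2) $\alpha([x,y,z])=[\alpha(x),\alpha(y),\alpha(z)]$ and $\beta([x,y,z])=[\beta(x),\beta(y),\beta(z)]$; (3) $[\beta(x),\beta(y),\alpha(z)]=-[\beta(y),\beta(x),\alpha(z)]=-[\beta(x),\beta(z),\alpha(y)]$; (4) $[\beta^2(u),\beta^2(v),[\beta(x),\beta(y),\alpha(z)]]=[\beta^2(y),\beta^2(z),[\beta(u),\beta(v),\alpha(x)]]-[\beta^2(x),\beta^2(z),[\beta(u),\beta(v),\alpha(y)]]+[\beta^2(x),\beta^2(y),[\beta(u),\beta(v),\alpha(z)]]$. A linear subspace $\eta\subseteq L$ is a Bihom subalgebra if $\alpha(\eta)\subseteq\eta$, $\beta(\eta)\subseteq\eta$ and $[x,y,z]\in\eta$ for all $x,y,z\in\eta$.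 An almost product structure on $L$ is a linear map $E\colon L\to L$ with $E^2=\mathrm{Id}$, $E\neq\pm\mathrm{Id}$, $\alpha E=E\alpha$ and $\beta E=E\beta$. An almost product structure $E$ is called a strict product structure if $E[x,y,z]=[Ex,y,z]$ for all $x,y,z\in L$. For subspaces $A,B,C\subseteq L$, $[A,B,C]$ denotes the span of all $[a,b,c]$ with $a\in A$, $b\in B$, $c\in C$.
   Formalization: L_+ and L_- are required to be nonzero (else L = L ⊕ 0 always works, though a one-dimensional L has no E ≠ ±Id with E² = Id), and the characteristic of K is assumed not to be 2 (the equivalence fails there, e.g. K = F_4, L = K², zero bracket, β = Id, α = diag(1,a), a ≠ 0,1). *)

theory Defs
  imports Complex_Main
begin

text \<open>
  The algebra \<open>L\<close> is the whole type \<open>'v\<close>, with scalar multiplication \<open>scale\<close> over the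
  field \<open>'k\<close>. No dimension restriction is made.
\<close>

locale three_bihom_lie_algebra = vector_space scale
  for scale :: "'k::field \<Rightarrow> 'v::ab_group_add \<Rightarrow> 'v" +
  fixes bracket :: "'v \<Rightarrow> 'v \<Rightarrow> 'v \<Rightarrow> 'v"
    and \<alpha> \<beta> :: "'v \<Rightarrow> 'v"
  assumes bracket_linear1: "Vector_Spaces.linear scale scale (\<lambda>x. bracket x y z)"
    and bracket_linear2: "Vector_Spaces.linear scale scale (\<lambda>y. bracket x y z)"
    and bracket_linear3: "Vector_Spaces.linear scale scale (\<lambda>z. bracket x y z)"
    and alpha_linear: "Vector_Spaces.linear scale scale \<alpha>"
    and beta_linear: "Vector_Spaces.linear scale scale \<beta>"
    and alpha_beta_commute: "\<alpha> \<circ> \<beta> = \<beta> \<circ> \<alpha>"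
    and alpha_bracket: "\<alpha> (bracket x y z) = bracket (\<alpha> x) (\<alpha> y) (\<alpha> z)"
    and beta_bracket: "\<beta> (bracket x y z) = bracket (\<beta> x) (\<beta> y) (\<beta> z)"
    and bihom_skew12: "bracket (\<beta> x) (\<beta> y) (\<alpha> z) = - bracket (\<beta> y) (\<beta> x) (\<alpha> z)"
    and bihom_skew23: "bracket (\<beta> x) (\<beta> y) (\<alpha> z) = - bracket (\<beta> x) (\<beta> z) (\<alpha> y)"
    and bihom_jacobi:
      "bracket (\<beta> (\<beta> u)) (\<beta> (\<beta> v)) (bracket (\<beta> x) (\<beta> y) (\<alpha> z)) =
         bracket (\<beta> (\<beta> y)) (\<beta> (\<beta> z)) (bracket (\<beta> u) (\<beta> v) (\<alpha> x))
       - bracket (\<beta> (\<beta> x)) (\<beta> (\<beta> z)) (bracket (\<beta> u) (\<beta> v) (\<alpha> y))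
       + bracket (\<beta> (\<beta> x)) (\<beta> (\<beta> y)) (bracket (\<beta> u) (\<beta> v) (\<alpha> z))"
begin

definition bihom_subalgebra :: "'v set \<Rightarrow> bool" where
  "bihom_subalgebra \<eta> \<longleftrightarrow>
     subspace \<eta> \<and> \<alpha> ` \<eta> \<subseteq> \<eta> \<and> \<beta> ` \<eta> \<subseteq> \<eta> \<and>
     (\<forall>x\<in>\<eta>. \<forall>y\<in>\<eta>. \<forall>z\<in>\<eta>. bracket x y z \<in> \<eta>)"

definition almost_product_structure :: "('v \<Rightarrow> 'v) \<Rightarrow> bool" where
  "almost_product_structure E \<longleftrightarrow>
     Vector_Spaces.linear scale scale E \<and> E \<circ> E = id \<and> E \<noteq> id \<and> E \<noteq> uminus \<and>
     \<alpha> \<circ> E = E \<circ> \<alpha> \<and> \<beta> \<circ> E = E \<circ> \<beta>"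

definition strict_product_structure :: "('v \<Rightarrow> 'v) \<Rightarrow> bool" where
  "strict_product_structure E \<longleftrightarrow>
     almost_product_structure E \<and> (\<forall>x y z. E (bracket x y z) = bracket (E x) y z)"

definition bracket_span :: "'v set \<Rightarrow> 'v set \<Rightarrow> 'v set \<Rightarrow> 'v set" where
  "bracket_span A B C = span {bracket a b c | a b c. a \<in> A \<and> b \<in> B \<and> c \<in> C}"

definition direct_decomposition :: "'v set \<Rightarrow> 'v set \<Rightarrow> bool" where
  "direct_decomposition A B \<longleftrightarrow>
     subspace A \<and> subspace B \<and> {a + b | a b. a \<in> A \<and> b \<in> B} = UNIV \<and> A \<inter> B = {0}"

end

end

theory Submission
  imports Defs
begin

text \<open>
  A strict product structure \<open>E\<close> is the reflection with eigenspaces \<open>L\<^sub>+\<close> and \<open>L\<^sub>-\<close>. Since \<open>\<alpha>\<close> and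
  \<open>\<beta>\<close> are onto and respect the decomposition, they map each summand onto itself, so the
  twisted skew-symmetry permutes the arguments of the bracket within products of the summands.
  Strictness puts a bracket into the eigenspace of its first argument; permuting the arguments of
  a mixed bracket puts it into both eigenspaces, so it vanishes. Conversely, if all mixed brackets
  vanish, strictness of the reflection only has to be checked on unmixed ones.
\<close>

lemmas lin_add = module_hom.add[OF module_hom_linearI]
  and lin_diff = module_hom.diff[OF module_hom_linearI]
  and lin_neg = module_hom.neg[OF module_hom_linearI]
  and lin_scale = module_hom.scale[OF module_hom_linearI]
  and lin_0 = module_hom.zero[OF module_hom_linearI]

context three_bihom_lie_algebra
begin

section \<open>Splittings of a vector space into two subspaces\<close>

lemma direct_decomposition_sym:
  assumes "direct_decomposition A B"
  shows "direct_decomposition B A"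
proof -
  have "{a + b |a b. a \<in> B \<and> b \<in> A} = {a + b |a b. a \<in> A \<and> b \<in> B}"
    by (rule Collect_cong) (metis add.commute)
  then show ?thesis
    using assms by (auto simp: direct_decomposition_def)
qed

lemma direct_decompositionE:
  assumes "direct_decomposition A B"
  obtains a b where "a \<in> A" "b \<in> B" "x = a + b"
proof -
  have "x \<in> {a + b |a b. a \<in> A \<and> b \<in> B}"
    using assms by (simp add: direct_decomposition_def)
  then show ?thesis using that by blast
qed

lemma direct_decomposition_unique:
  assumes "direct_decomposition A B"
    and "a \<in> A" "b \<in> B" "a' \<in> A" "b' \<in> B" "a + b = a' + b'"
  shows "a = a'" "b = b'"
proof -
  have eq: "a - a' = b' - b"
    using assms(6) by (simp add: algebra_simps)
  have "a - a' \<in> A" "b' - b \<in> B"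
    using assms by (simp_all add: direct_decomposition_def subspace_diff)
  then have "a - a' \<in> A \<inter> B"
    by (simp add: eq)
  moreover have "A \<inter> B = {0}"
    using assms(1) by (simp add: direct_decomposition_def)
  ultimately have "a - a' = 0"
    by blast
  then show "a = a'" "b = b'"
    using eq by simp_all
qed

text \<open>Split a preimage of a \<in> A as p + m. The images satisfy f p + f m = a + 0 with f p
  \<in> A and f m \<in> B, so uniqueness of components gives f p = a. Later this supplies preimages
  under \<alpha> and \<beta> that lie in the same summand.\<close>

lemma surj_invariant_summand:
  assumes dec: "direct_decomposition A B"
    and f: "Vector_Spaces.linear scale scale f" "surj f" "f ` A \<subseteq> A" "f ` B \<subseteq> B"
  shows "f ` A = A"
proof
  show "A \<subseteq> f ` A"
  proof
    fix a assume a: "a \<in> A"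
    obtain x where x: "a = f x" using f(2) by (rule surjE)
    obtain p m where pm: "p \<in> A" "m \<in> B" "x = p + m"
      using direct_decompositionE[OF dec] .
    have "0 \<in> B" using dec by (simp add: direct_decomposition_def subspace_0)
    moreover have "f p + f m = a + 0"
      using x pm(3) lin_add[OF f(1)] by simp
    ultimately have "f p = a"
      using direct_decomposition_unique(1)[OF dec, of "f p" "f m" a 0] f(3,4) pm(1,2) a by blast
    then show "a \<in> f ` A" using pm(1) by blast
  qed
qed (rule f(3))

lemma reflection_exists:
  assumes dec: "direct_decomposition A B"
  shows "\<exists>E. Vector_Spaces.linear scale scale E \<and> (\<forall>a\<in>A. E a = a) \<and> (\<forall>b\<in>B. E b = - b)"
proof -
  have sub: "subspace A" "subspace B"
    using dec by (simp_all add: direct_decomposition_def)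
  have "\<exists>y. \<exists>a\<in>A. \<exists>b\<in>B. x = a + b \<and> y = a - b" for x
    by (rule direct_decompositionE[OF dec, of x]) blast
  \<comment> \<open>Choice picks one splitting of each x. Uniqueness of components makes the value
    independent of the splitting, which is what \<open>E_sum\<close> records and what linearity
    rests on.\<close>
  then obtain E where E: "\<And>x. \<exists>a\<in>A. \<exists>b\<in>B. x = a + b \<and> E x = a - b"
    by metis
  have E_sum: "E (a + b) = a - b" if "a \<in> A" "b \<in> B" for a b
  proof -
    obtain a' b' where "a' \<in> A" "b' \<in> B" "a + b = a' + b'" "E (a + b) = a' - b'"
      using E[of "a + b"] by blast
    then show ?thesis
      using direct_decomposition_unique[OF dec that, of a' b'] by simp
  qed
  have "Vector_Spaces.linear scale scale E"
    unfolding Vector_Spaces.linear_iff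
  proof (intro conjI allI vector_space_axioms)
    fix x y
    obtain a b where x: "a \<in> A" "b \<in> B" "x = a + b" using direct_decompositionE[OF dec] .
    obtain c d where y: "c \<in> A" "d \<in> B" "y = c + d" using direct_decompositionE[OF dec] .
    have "E ((a + c) + (b + d)) = (a + c) - (b + d)"
      using x y sub by (intro E_sum subspace_add)
    then show "E (x + y) = E x + E y"
      using x y by (simp add: E_sum algebra_simps)
  next
    fix r x
    obtain a b where x: "a \<in> A" "b \<in> B" "x = a + b" using direct_decompositionE[OF dec] .
    have "E (scale r a + scale r b) = scale r a - scale r b"
      using x sub by (intro E_sum subspace_scale)
    then show "E (scale r x) = scale r (E x)"
      using x by (simp add: E_sum scale_right_distrib scale_right_diff_distrib)
  qed
  moreover have "\<forall>a\<in>A. E a = a" "\<forall>b\<in>B. E b = - b"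
    using E_sum[of _ 0] E_sum[of 0] sub by (auto simp: subspace_0)
  ultimately show ?thesis by blast
qed

section \<open>Vanishing brackets and permutation of arguments\<close>

lemma bracket_span_eq_0_iff:
  "bracket_span A B C = {0} \<longleftrightarrow> (\<forall>a\<in>A. \<forall>b\<in>B. \<forall>c\<in>C. bracket a b c = 0)"
proof
  assume zero: "bracket_span A B C = {0}"
  show "\<forall>a\<in>A. \<forall>b\<in>B. \<forall>c\<in>C. bracket a b c = 0"
  proof (intro ballI)
    fix a b c assume "a \<in> A" "b \<in> B" "c \<in> C"
    then have "bracket a b c \<in> bracket_span A B C"
      unfolding bracket_span_def by (intro span_base) blast
    then show "bracket a b c = 0"
      using zero by simp
  qed
next
  assume "\<forall>a\<in>A. \<forall>b\<in>B. \<forall>c\<in>C. bracket a b c = 0"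
  then have "{bracket a b c |a b c. a \<in> A \<and> b \<in> B \<and> c \<in> C} \<subseteq> {0}"
    by blast
  then have "bracket_span A B C \<subseteq> {0}"
    unfolding bracket_span_def by (rule span_minimal) simp
  then show "bracket_span A B C = {0}"
    using span_zero[of "{bracket a b c |a b c. a \<in> A \<and> b \<in> B \<and> c \<in> C}"]
    unfolding bracket_span_def by blast
qed

text \<open>The twisted identity puts \<beta> on both exchanged arguments, so passing to preimages
  and back returns the same elements and leaves ordinary skew-symmetry.\<close>

lemma bracket_swap12:
  assumes "surj \<alpha>" "surj \<beta>"
  shows "bracket x y z = - bracket y x z"
proof -
  obtain x0 where "x = \<beta> x0" using assms(2) by (rule surjE)
  moreover obtain y0 where "y = \<beta> y0" using assms(2) by (rule surjE)
  moreover obtain z0 where "z = \<alpha> z0" using assms(1) by (rule surjE)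
  ultimately show ?thesis using bihom_skew12[of x0 y0 z0] by simp
qed

text \<open>Here the exchanged slots carry different twists: \<beta> b0 and \<alpha> c0 turn into
  \<beta> c0 and \<alpha> b0. The elements change, but each stays in its own set, hence the
  existential form.\<close>

lemma bracket_swap23:
  assumes "surj \<beta>" and B: "\<beta> ` B = B" "\<alpha> ` B \<subseteq> B" and C: "\<alpha> ` C = C" "\<beta> ` C \<subseteq> C"
    and bc: "b \<in> B" "c \<in> C"
  shows "\<exists>b'\<in>B. \<exists>c'\<in>C. bracket a b c = - bracket a c' b'"
proof -
  obtain a0 where a0: "a = \<beta> a0" using assms(1) by (rule surjE)
  obtain b0 where b0: "b0 \<in> B" "b = \<beta> b0" using B bc by blast
  obtain c0 where c0: "c0 \<in> C" "c = \<alpha> c0" using C bc by blast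
  have "bracket a b c = - bracket a (\<beta> c0) (\<alpha> b0)"
    unfolding a0 b0(2) c0(2) by (rule bihom_skew23)
  then show ?thesis using b0(1) c0(1) B(2) C(2) by blast
qed

text \<open>The bracket lies in A because its first argument does. Exchanging the last two and then
  the first two arguments brings an element of B to the front, the two signs cancel, and the same
  bracket lies in B.\<close>

lemma mixed_bracket_eq_0:
  assumes onto: "surj \<alpha>" "surj \<beta>"
    and dec: "direct_decomposition A B"
    and inv: "\<alpha> ` A = A" "\<beta> ` A = A" "\<alpha> ` B = B" "\<beta> ` B = B"
    and A: "\<And>x y z. x \<in> A \<Longrightarrow> bracket x y z \<in> A"
    and B: "\<And>x y z. x \<in> B \<Longrightarrow> bracket x y z \<in> B"
    and abc: "a \<in> A" "b \<in> A" "c \<in> B"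
  shows "bracket a b c = 0"
proof -
  obtain b' c' where bc: "b' \<in> A" "c' \<in> B" "bracket a b c = - bracket a c' b'"
    using bracket_swap23[of A B b c a] onto inv abc by auto
  then have "bracket a b c = bracket c' a b'"
    using bracket_swap12[OF onto, of a c' b'] by simp
  then have "bracket a b c \<in> A \<inter> B"
    using A[OF abc(1)] B[OF bc(2)] by (metis IntI)
  moreover have "A \<inter> B = {0}"
    using dec by (simp add: direct_decomposition_def)
  ultimately show ?thesis
    by blast
qed

text \<open>Moves the odd argument from the last slot to the other two. The premise
  \<open>zero\<close> ranges over all elements because \<open>bracket_swap23\<close> replaces the
  arguments.\<close>

lemma mixed_brackets_eq_0:
  assumes onto: "surj \<alpha>" "surj \<beta>"
    and inv: "\<alpha> ` A = A" "\<beta> ` A = A" "\<alpha> ` B = B" "\<beta> ` B = B"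
    and zero: "\<And>a b c. a \<in> A \<Longrightarrow> b \<in> A \<Longrightarrow> c \<in> B \<Longrightarrow> bracket a b c = 0"
    and abc: "a \<in> A" "b \<in> A" "c \<in> B"
  shows "bracket a c b = 0" "bracket c a b = 0"
proof -
  have "\<exists>c'\<in>B. \<exists>b'\<in>A. bracket a c b = - bracket a b' c'"
    using onto inv abc by (intro bracket_swap23) auto
  then show "bracket a c b = 0" using zero abc by force
  then show "bracket c a b = 0" using bracket_swap12[OF onto, of c a b] by simp
qed

section \<open>From a strict product structure to a decomposition\<close>

lemma eigenspaces_direct_decomposition:
  assumes two: "(2::'k) \<noteq> 0"
    and lin: "Vector_Spaces.linear scale scale E" and "E \<circ> E = id"
  shows "direct_decomposition {x. E x = x} {x. E x = - x}"
proof -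
  note [simp] = lin_add[OF lin] lin_diff[OF lin] lin_scale[OF lin] lin_0[OF lin]
  have EE: "E (E x) = x" for x using assms(3) by (simp add: fun_eq_iff)
  have half: "scale (inverse 2) (x + x) = x" for x
  proof -
    have "scale (inverse 2) (x + x) = scale (inverse 2 * 2) x"
      by (simp add: scale_right_distrib flip: scale_left_distrib)
    then show ?thesis using two by simp
  qed
  have "\<exists>a b. x = a + b \<and> E a = a \<and> E b = - b" for x
  proof (intro exI conjI)
    \<comment> \<open>The components are the images of x under the projections (1 + E)/2 and (1 -
      E)/2.\<close>
    show "x = scale (inverse 2) (x + E x) + scale (inverse 2) (x - E x)"
      using half[of x] by (simp flip: scale_right_distrib)
    show "E (scale (inverse 2) (x + E x)) = scale (inverse 2) (x + E x)"
      by (simp add: EE add.commute)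
    show "E (scale (inverse 2) (x - E x)) = - scale (inverse 2) (x - E x)"
      by (simp add: EE flip: scale_minus_right)
  qed
  then have "{a + b |a b. a \<in> {x. E x = x} \<and> b \<in> {x. E x = - x}} = UNIV"
    by blast
  moreover have "{x. E x = x} \<inter> {x. E x = - x} = {0}"
  proof -
    \<comment> \<open>Both eigenvalue equations give x + x = 0, and halving gives x = 0.\<close>
    have "x = 0" if "E x = x" "E x = - x" for x
      using half[of x] that by (metis add.right_inverse scale_zero_right)
    then show ?thesis by auto
  qed
  ultimately show ?thesis
    by (simp add: direct_decomposition_def subspace_def)
qed

lemma eigenspaces_decomposition:
  assumes onto: "surj \<alpha>" "surj \<beta>" and two: "(2::'k) \<noteq> 0"
    and E: "strict_product_structure E"
  defines "P \<equiv> {x. E x = x}" and "M \<equiv> {x. E x = - x}"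
  shows "direct_decomposition P M \<and> P \<noteq> {0} \<and> M \<noteq> {0} \<and>
    bihom_subalgebra P \<and> bihom_subalgebra M \<and>
    bracket_span P P M = {0} \<and> bracket_span M M P = {0}"
proof -
  have lin: "Vector_Spaces.linear scale scale E" and invol: "E \<circ> E = id"
    and ne: "E \<noteq> id" "E \<noteq> uminus"
    and "\<alpha> \<circ> E = E \<circ> \<alpha>" "\<beta> \<circ> E = E \<circ> \<beta>"
    and strict: "\<And>x y z. E (bracket x y z) = bracket (E x) y z"
    using E unfolding strict_product_structure_def almost_product_structure_def by blast+
  then have comm: "E (\<alpha> x) = \<alpha> (E x)" "E (\<beta> x) = \<beta> (E x)" for x
    by (simp_all add: fun_eq_iff)
  have dec: "direct_decomposition P M"
    unfolding P_def M_def by (rule eigenspaces_direct_decomposition[OF two lin invol])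
  note dec' = direct_decomposition_sym[OF dec]
  have sub: "subspace P" "subspace M"
    using dec by (simp_all add: direct_decomposition_def)
  have EE: "E (E x) = x" for x using invol by (simp add: fun_eq_iff)
  \<comment> \<open>E fixes every E x + x, so a trivial P would force E = -id. Dually, a trivial M
    would force E = id.\<close>
  have P: "P \<noteq> {0}"
  proof
    assume "P = {0}"
    moreover have "E x + x \<in> P" for x
      by (simp add: P_def lin_add[OF lin] EE add.commute)
    ultimately have "E x + x = 0" for x by blast
    then show False using ne(2) by (auto simp: fun_eq_iff eq_neg_iff_add_eq_0)
  qed
  have M: "M \<noteq> {0}"
  proof
    assume "M = {0}"
    moreover have "E x - x \<in> M" for x
      by (simp add: M_def lin_diff[OF lin] EE)
    ultimately have "E x - x = 0" for x by blast
    then show False using ne(1) by (auto simp: fun_eq_iff)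
  qed
  have sub_inv: "\<alpha> ` P \<subseteq> P" "\<beta> ` P \<subseteq> P" "\<alpha> ` M \<subseteq> M" "\<beta> ` M \<subseteq> M"
    using lin_neg[OF alpha_linear] lin_neg[OF beta_linear]
    by (auto simp: P_def M_def comm)
  \<comment> \<open>By strictness the first argument alone decides the eigenspace, which is stronger
    than closure as a subalgebra.\<close>
  have closed: "x \<in> P \<Longrightarrow> bracket x y z \<in> P" "x \<in> M \<Longrightarrow> bracket x y z \<in> M" for x y z
    using lin_neg[OF bracket_linear1] by (auto simp: P_def M_def strict)
  have inv: "\<alpha> ` P = P" "\<beta> ` P = P" "\<alpha> ` M = M" "\<beta> ` M = M"
    using surj_invariant_summand[OF dec] surj_invariant_summand[OF dec']
      sub_inv onto alpha_linear beta_linear by blast+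
  have "bihom_subalgebra P" "bihom_subalgebra M"
    using sub sub_inv closed by (auto simp: bihom_subalgebra_def)
  moreover have "bracket_span P P M = {0}" "bracket_span M M P = {0}"
    using mixed_bracket_eq_0[OF onto dec inv closed]
      mixed_bracket_eq_0[OF onto dec' inv(3,4,1,2) closed(2,1)]
    by (simp_all add: bracket_span_eq_0_iff)
  ultimately show ?thesis using dec P M by blast
qed

section \<open>From a decomposition to a strict product structure\<close>

lemma strict_product_structure_exists:
  assumes onto: "surj \<alpha>" "surj \<beta>" and two: "(2::'k) \<noteq> 0"
    and dec: "direct_decomposition P M" and ne: "P \<noteq> {0}" "M \<noteq> {0}"
    and subalg: "bihom_subalgebra P" "bihom_subalgebra M"
    and zero: "bracket_span P P M = {0}" "bracket_span M M P = {0}"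
  shows "\<exists>E. strict_product_structure E"
proof -
  note dec' = direct_decomposition_sym[OF dec]
  obtain E where lin: "Vector_Spaces.linear scale scale E"
    and EP: "\<And>a. a \<in> P \<Longrightarrow> E a = a" and EM: "\<And>b. b \<in> M \<Longrightarrow> E b = - b"
    using reflection_exists[OF dec] by blast
  note E_simps = EP EM lin_add[OF lin] lin_neg[OF lin]
  have sub: "subspace P" "subspace M"
    using dec by (simp_all add: direct_decomposition_def)
  note zero_mem = sub[THEN subspace_0]
  have sub_inv: "\<alpha> ` P \<subseteq> P" "\<beta> ` P \<subseteq> P" "\<alpha> ` M \<subseteq> M" "\<beta> ` M \<subseteq> M"
    and closed: "\<And>x y z. x \<in> P \<Longrightarrow> y \<in> P \<Longrightarrow> z \<in> P \<Longrightarrow> bracket x y z \<in> P"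
      "\<And>x y z. x \<in> M \<Longrightarrow> y \<in> M \<Longrightarrow> z \<in> M \<Longrightarrow> bracket x y z \<in> M"
    using subalg by (auto simp: bihom_subalgebra_def)
  have inv: "\<alpha> ` P = P" "\<beta> ` P = P" "\<alpha> ` M = M" "\<beta> ` M = M"
    using surj_invariant_summand[OF dec] surj_invariant_summand[OF dec']
      sub_inv onto alpha_linear beta_linear by blast+
  have PPM: "bracket a b c = 0" if "a \<in> P" "b \<in> P" "c \<in> M" for a b c
    using zero that by (simp add: bracket_span_eq_0_iff)
  have MMP: "bracket a b c = 0" if "a \<in> M" "b \<in> M" "c \<in> P" for a b c
    using zero that by (simp add: bracket_span_eq_0_iff)
  \<comment> \<open>These cover all six mixed patterns of the three arguments; only PPP and MMM
    remain.\<close>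
  note mixed = PPM MMP mixed_brackets_eq_0[OF onto inv PPM]
    mixed_brackets_eq_0[OF onto inv(3,4,1,2) MMP]
  \<comment> \<open>Rules out E = id and E = -id, either of which would make every element of M or
    of P its own negative.\<close>
  have no_self_neg: "x = 0" if "x = - x" for x :: 'v
  proof -
    have "scale 2 x = 0"
      using that by (metis add.right_inverse one_add_one scale_left_distrib scale_one)
    then show ?thesis using two by simp
  qed
  have "E (bracket x y z) = bracket (E x) y z" for x y z
  proof -
    obtain a b where x: "a \<in> P" "b \<in> M" "x = a + b" using direct_decompositionE[OF dec] .
    obtain c d where y: "c \<in> P" "d \<in> M" "y = c + d" using direct_decompositionE[OF dec] .
    obtain e f where z: "e \<in> P" "f \<in> M" "z = e + f" using direct_decompositionE[OF dec] .
    \<comment> \<open>After trilinear expansion both sides reduce to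
      \<open>bracket a c e - bracket b d f\<close>.\<close>
    show ?thesis
      using x y z closed
      by (simp add: E_simps mixed lin_neg[OF bracket_linear1] lin_diff[OF bracket_linear1]
          lin_add[OF bracket_linear1] lin_add[OF bracket_linear2] lin_add[OF bracket_linear3])
  qed
  moreover have "E \<circ> E = id" "\<alpha> \<circ> E = E \<circ> \<alpha>" "\<beta> \<circ> E = E \<circ> \<beta>"
  proof -
    have "E (E x) = x \<and> \<alpha> (E x) = E (\<alpha> x) \<and> \<beta> (E x) = E (\<beta> x)" for x
    proof -
      obtain a b where x: "a \<in> P" "b \<in> M" "x = a + b" using direct_decompositionE[OF dec] .
      then have "\<alpha> a \<in> P" "\<beta> a \<in> P" "\<alpha> b \<in> M" "\<beta> b \<in> M"
        using sub_inv by blast+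
      then show ?thesis
        using x by (simp add: E_simps lin_diff[OF lin] lin_add[OF alpha_linear]
            lin_add[OF beta_linear] lin_diff[OF alpha_linear] lin_diff[OF beta_linear])
    qed
    then show "E \<circ> E = id" "\<alpha> \<circ> E = E \<circ> \<alpha>" "\<beta> \<circ> E = E \<circ> \<beta>"
      by (simp_all add: fun_eq_iff)
  qed
  moreover have "E \<noteq> id"
  proof
    assume "E = id"
    then have "b = 0" if "b \<in> M" for b using EM[OF that] no_self_neg[of b] by simp
    then show False using ne(2) zero_mem by blast
  qed
  moreover have "E \<noteq> uminus"
  proof
    assume "E = uminus"
    then have "a = 0" if "a \<in> P" for a using EP[OF that] no_self_neg[of a] by simp
    then show False using ne(1) zero_mem by blast
  qed
  ultimately show ?thesis
    using lin by (auto simp: strict_product_structure_def almost_product_structure_def)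
qed

end

text \<open>Nonzero summands match E \<noteq> id and E \<noteq> -id: the splitting of L into L and
  {0} always satisfies the other conditions, but its reflection is id or -id. In characteristic 2
  the two eigenspaces would coincide.\<close>

theorem corollary3p6:
  fixes scale :: "'k::field \<Rightarrow> 'v::ab_group_add \<Rightarrow> 'v"
    and bracket :: "'v \<Rightarrow> 'v \<Rightarrow> 'v \<Rightarrow> 'v"
    and \<alpha> \<beta> :: "'v \<Rightarrow> 'v"
  assumes "three_bihom_lie_algebra scale bracket \<alpha> \<beta>"
    and "surj \<alpha>" and "surj \<beta>"
    and "(2::'k) \<noteq> 0"
  shows "(\<exists>E. three_bihom_lie_algebra.strict_product_structure scale bracket \<alpha> \<beta> E) \<longleftrightarrow>
    (\<exists>Lp Lm.
       three_bihom_lie_algebra.direct_decomposition scale Lp Lm \<and>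
       Lp \<noteq> {0} \<and> Lm \<noteq> {0} \<and>
       three_bihom_lie_algebra.bihom_subalgebra scale bracket \<alpha> \<beta> Lp \<and>
       three_bihom_lie_algebra.bihom_subalgebra scale bracket \<alpha> \<beta> Lm \<and>
       three_bihom_lie_algebra.bracket_span scale bracket Lp Lp Lm = {0} \<and>
       three_bihom_lie_algebra.bracket_span scale bracket Lm Lm Lp = {0})"
proof -
  interpret three_bihom_lie_algebra scale bracket \<alpha> \<beta>
    by (rule assms(1))
  show ?thesis
  proof (rule iffI; elim exE conjE)
    fix E assume "strict_product_structure E"
    then show "\<exists>Lp Lm. direct_decomposition Lp Lm \<and> Lp \<noteq> {0} \<and> Lm \<noteq> {0} \<and>
        bihom_subalgebra Lp \<and> bihom_subalgebra Lm \<and>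
        bracket_span Lp Lp Lm = {0} \<and> bracket_span Lm Lm Lp = {0}"
      by (intro exI) (rule eigenspaces_decomposition[OF assms(2-4)])
  qed (rule strict_product_structure_exists[OF assms(2-4)])
qed

end
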